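(* Let $p$ be a prime. Every non-cyclic finite $p$-group has an equal covering.
   Context: A covering of a group $G$ is a collection of proper subgroups of $G$ whose set-theoretic union is $G$. An equal covering of $G$ is a covering of $G$ all of whose members have the same order. *)

theory Defs
  imports
    "HOL-Algebra.Elementary_Groups"
    "HOL-Algebra.Multiplicative_Group"
    "HOL-Computational_Algebra.Primes"
begin

(* ord is 0 on elements of infinite order, so these are excluded because p ^ k > 0. *)
definition p_group :: "nat \<Rightarrow> ('a, 'b) monoid_scheme \<Rightarrow> bool" where
  "p_group p G \<longleftrightarrow>
     prime p \<and> group G \<and> (\<forall>x\<in>carrier G. \<exists>k::nat. group.ord G x = p ^ k)"

definition group_covering :: "('a, 'b) monoid_scheme \<Rightarrow> 'a set set \<Rightarrow> bool" where
  "group_covering G \<C> \<longleftrightarrow>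
     (\<forall>H\<in>\<C>. subgroup H G \<and> H \<noteq> carrier G) \<and> \<Union>\<C> = carrier G"

(* Orders are compared through card, which is 0 on every infinite set;
   the notion is only meant for finite G. *)
definition equal_covering :: "('a, 'b) monoid_scheme \<Rightarrow> 'a set set \<Rightarrow> bool" where
  "equal_covering G \<C> \<longleftrightarrow>
     group_covering G \<C> \<and> (\<forall>H\<in>\<C>. \<forall>K\<in>\<C>. card H = card K)"

end

theory Submission
  imports Defs "HOL-Algebra.Sylow" "HOL-Algebra.Zassenhaus"
begin

text \<open>
  A finite \<open>p\<close>-group \<open>G\<close> has order \<open>p ^ n\<close> by Cauchy's theorem. Letting a proper subgroup \<open>M\<close> act
  on its own cosets and counting fixed points modulo \<open>p\<close> shows that \<open>M\<close> is strictly smaller than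
  its normalizer. So a maximal subgroup \<open>M\<close> is normal, and if \<open>x \<notin> M\<close> but \<open>x ^ p \<in> M\<close>, then
  \<open>G = M\<langle>x\<rangle>\<close> is the union of \<open>M x ^ i\<close> for \<open>i < p\<close>; hence \<open>M\<close> has index \<open>p\<close>.
  If \<open>G\<close> is not cyclic, every element lies in a proper cyclic subgroup and therefore in a
  maximal one, so the maximal subgroups form an equal covering.
\<close>

section \<open>Fixed points of actions of a \<open>p\<close>-group\<close>

text \<open>Orbit sizes divide \<open>p ^ k\<close>, so an orbit with more than one point has size
  divisible by \<open>p\<close>. Were \<open>x\<close> the only fixed point, the other orbits would
  partition \<open>E - {x}\<close>, and \<open>p\<close> would divide both \<open>card E\<close> and
  \<open>card E - 1\<close>.\<close>

lemma (in group_action) p_group_another_fixed_point: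
  assumes "prime p" "order G = p ^ k" "finite E" "p dvd card E"
    and x: "x \<in> E" "\<And>g. g \<in> carrier G \<Longrightarrow> \<phi> g x = x"
  shows "\<exists>y\<in>E. y \<noteq> x \<and> (\<forall>g\<in>carrier G. \<phi> g y = y)"
proof (rule ccontr)
  assume "\<not> ?thesis"
  then have nofix: "\<exists>g\<in>carrier G. \<phi> g y \<noteq> y" if "y \<in> E" "y \<noteq> x" for y
    using that by blast
  interpret G: group G
    by (rule group_hom.axioms(1)[OF group_hom])
  have orbx: "orbit G \<phi> x = {x}"
    using x(2) G.one_closed by (force simp: orbit_def)
  define C where "C = orbits G E \<phi> - {{x}}"
  have xin: "{x} \<in> orbits G E \<phi>"
    using orbx x(1) unfolding orbits_def by blast
  have UC: "\<Union>C = E - {x}"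
  proof
    show "\<Union>C \<subseteq> E - {x}"
      using orbits_coverture disjoint_union[OF _ xin] unfolding C_def by blast
    show "E - {x} \<subseteq> \<Union>C"
      using orbits_coverture unfolding C_def by blast
  qed
  have "p dvd card c" if c: "c \<in> C" for c
  proof -
    from c obtain y where y: "y \<in> E" "c = orbit G \<phi> y"
      unfolding C_def orbits_def by blast
    have "y \<noteq> x"
      using y orbx c unfolding C_def by blast
    then obtain g where g: "g \<in> carrier G" "\<phi> g y \<noteq> y"
      using nofix y(1) by blast
    have "c \<subseteq> E"
      using c orbits_coverture unfolding C_def by blast
    then have "finite c"
      using \<open>finite E\<close> finite_subset by blast
    have sub: "{y, \<phi> g y} \<subseteq> c"
      using y orbit_refl[of y] g(1) unfolding orbit_def by blast
    have "card {y, \<phi> g y} = 2"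
      using g(2) by simp
    then have "card c \<noteq> 1"
      using card_mono[OF \<open>finite c\<close> sub] by linarith
    have "card c dvd p ^ k"
      using orbit_stabilizer_theorem[OF y(1)] assms(2) y(2) by (metis dvd_triv_left)
    then obtain i where "card c = p ^ i"
      using divides_primepow_nat[OF \<open>prime p\<close>] by blast
    then show ?thesis
      using \<open>card c \<noteq> 1\<close> by (cases i) auto
  qed
  moreover have "\<forall>c1\<in>C. \<forall>c2\<in>C. c1 \<noteq> c2 \<longrightarrow> c1 \<inter> c2 = {}"
    using disjoint_union unfolding C_def by blast
  moreover have "finite (\<Union>C)"
    using UC \<open>finite E\<close> by simp
  ultimately have "p dvd card (E - {x})"
    using dvd_partition[of C p] UC by simp
  moreover have "card E = Suc (card (E - {x}))"
    using \<open>finite E\<close> x(1) card_Suc_Diff1 by metis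
  ultimately have "p dvd 1"
    using assms(4) dvd_add_right_iff[of p "card (E - {x})" 1] by simp
  then show False
    using \<open>prime p\<close> by (simp add: prime_nat_iff)
qed

context group
begin

section \<open>Normalizers of proper subgroups\<close>

text \<open>The inverse turns multiplication from the right into a left action, since
  \<open>inv (g \<otimes> h)\<close> reverses the factors. The map is restricted to
  \<open>rcosets H\<close> because the elements of \<open>BijGroup\<close> are extensional.\<close>

lemma rcosets_group_action:
  assumes "subgroup H G"
  shows "group_action G (rcosets H) (\<lambda>g. \<lambda>C\<in>rcosets H. C #> inv g)"
proof -
  have H: "H \<subseteq> carrier G"
    using assms subgroup.subset by blast
  have closed: "C #> g \<in> rcosets H" if "C \<in> rcosets H" "g \<in> carrier G" for C g
    using that H by (auto simp: RCOSETS_def coset_mult_assoc)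
  have sub: "C \<subseteq> carrier G" if "C \<in> rcosets H" for C
    using that assms subgroup.rcosets_carrier is_group by blast
  have bij: "(\<lambda>C\<in>rcosets H. C #> inv g) \<in> Bij (rcosets H)" if g: "g \<in> carrier G" for g
  proof -
    have "bij_betw (\<lambda>C\<in>rcosets H. C #> inv g) (rcosets H) (rcosets H)"
      by (rule bij_betw_byWitness[where f' = "\<lambda>C. C #> g"])
        (use g closed sub in \<open>auto simp: coset_mult_assoc\<close>)
    then show ?thesis
      by (simp add: Bij_def)
  qed
  show ?thesis
    unfolding group_action_def group_hom_def group_hom_axioms_def
  proof (intro conjI is_group group_BijGroup homI)
    show "(\<lambda>C\<in>rcosets H. C #> inv g) \<in> carrier (BijGroup (rcosets H))"
      if "g \<in> carrier G" for g
      using bij[OF that] by (simp add: BijGroup_def)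
    show "(\<lambda>C\<in>rcosets H. C #> inv (g \<otimes> h)) =
        (\<lambda>C\<in>rcosets H. C #> inv g) \<otimes>\<^bsub>BijGroup (rcosets H)\<^esub> (\<lambda>C\<in>rcosets H. C #> inv h)"
      if "g \<in> carrier G" "h \<in> carrier G" for g h
      using that bij closed sub
      by (auto simp: BijGroup_def compose_def coset_mult_assoc inv_mult_group fun_eq_iff)
  qed
qed

text \<open>A coset \<open>H #> g\<close> is fixed under right multiplication by all of
  \<open>H\<close> exactly when \<open>g\<close> conjugates \<open>H\<close> into itself. The coset
  \<open>H\<close> is fixed and \<open>p\<close> divides the index, so there is a second fixed
  coset; its representative lies outside \<open>H\<close>.\<close>

lemma p_group_normalizer_grows:
  assumes "prime p" "order G = p ^ n" and H: "subgroup H G" "H \<noteq> carrier G"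
  obtains g where "g \<in> carrier G" "g \<notin> H" "\<And>h. h \<in> H \<Longrightarrow> g \<otimes> h \<otimes> inv g \<in> H"
proof -
  have fin: "finite (carrier G)"
    using assms(1,2) by (metis order_gt_0_iff_finite prime_gt_0_nat zero_less_power)
  have sub: "H \<subseteq> carrier G"
    using H(1) subgroup.subset by blast
  have lag: "card (rcosets H) * card H = p ^ n"
    using lagrange[OF H(1)] assms(2) by simp
  obtain k where k: "card H = p ^ k"
    using lag divides_primepow_nat[OF \<open>prime p\<close>] by (metis dvd_triv_right)
  obtain j where j: "card (rcosets H) = p ^ j"
    using lag divides_primepow_nat[OF \<open>prime p\<close>] by (metis dvd_triv_left)
  have "card (rcosets H) \<noteq> 1"
  proof
    assume "card (rcosets H) = 1"
    then have "card H = card (carrier G)"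
      using lag assms(2) by (simp add: order_def)
    then show False
      using card_subset_eq[OF fin sub] H(2) by blast
  qed
  then have "p dvd card (rcosets H)"
    using j by (cases j) auto
  have finC: "finite (rcosets H)"
    using rcosets_subset_PowG[OF H(1)] fin by (meson finite_Pow_iff finite_subset)
  define \<phi> where "\<phi> = (\<lambda>g. \<lambda>C\<in>rcosets H. C #> inv g)"
  \<comment> \<open>The action is restricted to \<open>H\<close>, which makes the coset
    \<open>H\<close> a fixed point; the acting group has order \<open>p ^ k\<close>.\<close>
  interpret A: group_action "G\<lparr>carrier := H\<rparr>" "rcosets H" \<phi>
    unfolding \<phi>_def
    using group_action.induced_action[OF rcosets_group_action[OF H(1)] H(1)] .
  have HC: "H \<in> rcosets H"
    using subgroup.subgroup_in_rcosets[OF H(1) is_group] .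
  have "\<phi> h H = H" if "h \<in> H" for h
    using that HC subgroup.rcos_const[OF H(1) is_group] subgroup.m_inv_closed[OF H(1)]
    by (simp add: \<phi>_def)
  then obtain C where C: "C \<in> rcosets H" "C \<noteq> H" "\<And>h. h \<in> H \<Longrightarrow> \<phi> h C = C"
    using A.p_group_another_fixed_point[OF \<open>prime p\<close> _ finC \<open>p dvd card (rcosets H)\<close> HC, of k] k
    by (simp add: order_def) blast
  from C(1) obtain g where g: "g \<in> carrier G" "C = H #> g"
    by (auto simp: RCOSETS_def)
  show ?thesis
  proof
    show "g \<in> carrier G" by fact
    show "g \<notin> H"
      using C(2) g(2) subgroup.rcos_const[OF H(1) is_group] by blast
    fix h assume h: "h \<in> H"
    then have hG: "h \<in> carrier G"
      using sub by blast
    \<comment> \<open>As \<open>\<phi>\<close> multiplies by the inverse, applying it to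
      \<open>inv h\<close> gives invariance under \<open>h\<close>.\<close>
    have "C #> inv (inv h) = C"
      using C(1) C(3)[of "inv h"] subgroup.m_inv_closed[OF H(1) h] by (simp add: \<phi>_def)
    then have "H #> (g \<otimes> h) = H #> g"
      using g sub hG by (simp add: coset_mult_assoc)
    then have "g \<otimes> h \<in> H #> g"
      using rcos_self[OF _ H(1), of "g \<otimes> h"] g(1) hG by simp
    then show "g \<otimes> h \<otimes> inv g \<in> H"
      using subgroup.rcos_module_imp[OF H(1) is_group g(1)] by blast
  qed
qed

section \<open>Maximal subgroups\<close>

text \<open>The normalizer \<open>N\<close> is a subgroup strictly larger than \<open>M\<close>, so
  maximality makes it all of \<open>G\<close>.\<close>

lemma p_group_maximal_imp_normal:
  assumes "prime p" "order G = p ^ n" and M: "subgroup M G" "M \<noteq> carrier G"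
    and max: "\<And>K. \<lbrakk>subgroup K G; M \<subseteq> K; K \<noteq> carrier G\<rbrakk> \<Longrightarrow> K = M"
  shows "M \<lhd> G"
proof -
  have fin: "finite (carrier G)"
    using assms(1,2) by (metis order_gt_0_iff_finite prime_gt_0_nat zero_less_power)
  have sub: "M \<subseteq> carrier G"
    using M(1) subgroup.subset by blast
  interpret M: subgroup M G by fact
  define N where "N = {g \<in> carrier G. \<forall>h\<in>M. g \<otimes> h \<otimes> inv g \<in> M}"
  have "subgroup N G"
  proof (rule subgroupI)
    show "N \<subseteq> carrier G" "N \<noteq> {}"
      using sub by (auto simp: N_def intro!: exI[of _ \<one>])
    show "a \<otimes> b \<in> N" if "a \<in> N" "b \<in> N" for a b
    proof -
      have "a \<otimes> b \<otimes> h \<otimes> inv (a \<otimes> b) = a \<otimes> (b \<otimes> h \<otimes> inv b) \<otimes> inv a" if "h \<in> M" for h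
        using that \<open>a \<in> N\<close> \<open>b \<in> N\<close> sub by (auto simp: N_def inv_mult_group m_assoc)
      then show ?thesis
        using that by (auto simp: N_def)
    qed
    \<comment> \<open>Conjugation by \<open>a\<close> is only known to map \<open>M\<close> into itself; finiteness makes it onto.\<close>
    show "inv a \<in> N" if a: "a \<in> N" for a
    proof -
      have aG: "a \<in> carrier G" and into: "(\<lambda>h. a \<otimes> h \<otimes> inv a) ` M \<subseteq> M"
        using a by (auto simp: N_def)
      have inj: "inj_on (\<lambda>h. a \<otimes> h \<otimes> inv a) M"
      proof (rule inj_onI)
        fix h h' assume h: "h \<in> M" "h' \<in> M" "a \<otimes> h \<otimes> inv a = a \<otimes> h' \<otimes> inv a"
        then have "h \<in> carrier G" "h' \<in> carrier G"
          using sub by auto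
        with h(3) aG show "h = h'"
          by (simp add: right_cancel)
      qed
      have onto: "(\<lambda>h. a \<otimes> h \<otimes> inv a) ` M = M"
        using endo_inj_surj[OF finite_subset[OF sub fin] into inj] .
      have "inv a \<otimes> h \<otimes> a \<in> M" if "h \<in> M" for h
      proof -
        from that onto obtain h' where h': "h' \<in> M" "h = a \<otimes> h' \<otimes> inv a"
          by blast
        have "inv a \<otimes> h \<otimes> a = h'"
          using h' aG sub by (simp add: m_assoc inv_solve_left' subset_iff)
        then show ?thesis
          using h' by simp
      qed
      then show ?thesis
        using aG by (simp add: N_def)
    qed
  qed
  moreover have "M \<subseteq> N"
    using sub by (auto simp: N_def)
  moreover have "N \<noteq> M"
    by (rule p_group_normalizer_grows[OF assms(1-2) M]) (auto simp: N_def)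
  ultimately have "N = carrier G"
    using max by blast
  then show ?thesis
    using M(1) unfolding normal_inv_iff N_def by blast
qed

lemma p_group_maximal_index:
  assumes "prime p" "order G = p ^ n" and M: "subgroup M G" "M \<noteq> carrier G"
    and max: "\<And>K. \<lbrakk>subgroup K G; M \<subseteq> K; K \<noteq> carrier G\<rbrakk> \<Longrightarrow> K = M"
  shows "p * card M = order G"
proof -
  have sub: "M \<subseteq> carrier G"
    using M(1) subgroup.subset by blast
  have fin: "finite (carrier G)"
    using assms(1,2) by (metis order_gt_0_iff_finite prime_gt_0_nat zero_less_power)
  interpret M: normal M G
    using p_group_maximal_imp_normal[OF assms] .
  obtain y where y: "y \<in> carrier G" "y \<notin> M"
    using M(2) sub by blast
  \<comment> \<open>Taking \<open>p\<close>-th powers of \<open>y\<close> repeatedly reaches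
    \<open>\<one>\<close> after \<open>n\<close> steps, so there is a first step that enters
    \<open>M\<close>. The power just before it becomes \<open>x\<close>, which is outside
    \<open>M\<close> while \<open>x [^] p\<close> is inside.\<close>
  define j where "j = (LEAST j. y [^] (p ^ j) \<in> M)"
  have "y [^] (p ^ n) \<in> M"
    using pow_order_eq_1[OF y(1)] assms(2) by simp
  then have j: "y [^] (p ^ j) \<in> M"
    unfolding j_def by (rule LeastI)
  with y have "j \<noteq> 0"
    by (cases j) auto
  then obtain i where i: "j = Suc i"
    using not0_implies_Suc by blast
  define x where "x = y [^] (p ^ i)"
  have x: "x \<in> carrier G" "x \<notin> M"
    using y(1) not_less_Least[of i "\<lambda>j. y [^] (p ^ j) \<in> M"] i by (auto simp: x_def j_def)
  have xp: "x [^] p \<in> M"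
    using j y(1) by (simp add: x_def i nat_pow_pow mult.commute)
  \<comment> \<open>Normality of \<open>M\<close> makes this product a subgroup. It contains
    \<open>M\<close> and also \<open>x\<close>, so maximality forces it to be
    \<open>G\<close>.\<close>
  define K where "K = M <#> generate G {x}"
  have K: "subgroup K G"
    unfolding K_def using mult_norm_subgroup[OF M.normal_axioms] generate_is_subgroup x(1) by simp
  have "M \<subseteq> K"
  proof
    fix m assume "m \<in> M"
    then have "m \<otimes> \<one> \<in> K"
      unfolding K_def set_mult_def using generate.one by blast
    then show "m \<in> K"
      using \<open>m \<in> M\<close> sub by auto
  qed
  moreover have "x \<in> K"
  proof -
    have "\<one> \<otimes> x \<in> K"
      unfolding K_def set_mult_def using M.one_closed generate.incl[of x "{x}" G] by blast
    then show ?thesis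
      using x(1) by simp
  qed
  ultimately have KG: "K = carrier G"
    using max[OF K] x(2) by blast
  \<comment> \<open>Division of the exponent by \<open>p\<close> splits off a power of
    \<open>x [^] p\<close>, which \<open>M\<close> absorbs; only the remainders below
    \<open>p\<close> can give different cosets.\<close>
  have cos: "rcosets M \<subseteq> (\<lambda>i. M #> x [^] i) ` {..<p}"
  proof
    fix C assume "C \<in> rcosets M"
    then obtain g where g: "g \<in> carrier G" "C = M #> g"
      by (auto simp: RCOSETS_def)
    then obtain m z where mz: "m \<in> M" "z \<in> generate G {x}" "g = m \<otimes> z"
      using KG unfolding K_def set_mult_def by blast
    \<comment> \<open>Natural exponents suffice because \<open>x\<close> has finite order.\<close>
    obtain k :: nat where k: "z = x [^] k"
      using mz(2) generate_pow_nat[OF x(1)] ord_ge_1[OF fin x(1)] by force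
    have "(x [^] p) [^] (k div p) \<otimes> x [^] (k mod p) = x [^] k"
      using x(1) by (simp add: nat_pow_pow nat_pow_mult)
    then have "g = (m \<otimes> (x [^] p) [^] (k div p)) \<otimes> x [^] (k mod p)"
      using mz k x(1) sub by (simp add: m_assoc subset_iff)
    moreover have "m \<otimes> (x [^] p) [^] (k div p) \<in> M"
      using mz(1) xp
      by (metis M.m_closed M.subgroup_axioms subgroup_int_pow_closed int_pow_int)
    ultimately have "C = M #> x [^] (k mod p)"
      using g(2) x(1) sub M.rcos_const[OF is_group]
        coset_mult_assoc[OF sub, of "m \<otimes> (x [^] p) [^] (k div p)" "x [^] (k mod p)"]
      by (simp add: subset_iff)
    moreover have "k mod p < p"
      using \<open>prime p\<close> prime_gt_0_nat by simp
    ultimately show "C \<in> (\<lambda>i. M #> x [^] i) ` {..<p}"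
      by blast
  qed
  have le: "card (rcosets M) \<le> p"
    using surj_card_le[OF _ cos] by simp
  have lag: "card (rcosets M) * card M = order G"
    using lagrange[OF M(1)] .
  then have "card (rcosets M) dvd p ^ n"
    using assms(2) by (metis dvd_triv_left)
  then obtain l where l: "card (rcosets M) = p ^ l"
    using divides_primepow_nat[OF \<open>prime p\<close>] by blast
  \<comment> \<open>The index is a power of \<open>p\<close>, at most \<open>p\<close>, and not 1
    because \<open>M\<close> is proper; hence it is \<open>p\<close>.\<close>
  have "l \<noteq> 0"
  proof
    assume "l = 0"
    then have "card M = card (carrier G)"
      using lag l by (simp add: order_def)
    then show False
      using card_subset_eq[OF fin sub] M(2) by blast
  qed
  moreover have "l \<le> 1"
    using le l \<open>prime p\<close> prime_gt_1_nat[of p] power_le_imp_le_exp[of p l 1] by simp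
  ultimately have "l = 1"
    by simp
  then show ?thesis
    using l lag by simp
qed

section \<open>The order of a finite \<open>p\<close>-group\<close>

text \<open>Cauchy's theorem. Sylow's theorem with exponent 1 gives a subgroup of order
  \<open>q\<close>, and any nontrivial element of it has order \<open>q\<close>.\<close>

lemma prime_dvd_order_imp_exists_ord:
  assumes "prime q" "finite (carrier G)" "q dvd order G"
  obtains x where "x \<in> carrier G" "ord x = q"
proof -
  obtain m where "order G = q ^ 1 * m"
    using assms(3) by auto
  then obtain H where H: "subgroup H G" "card H = q"
    using sylow_thm[OF assms(1) is_group _ assms(2), of 1 m] by auto
  then have "\<not> H \<subseteq> {\<one>}"
    using assms(1) card_mono[of "{\<one>}" H] prime_gt_1_nat[of q] by auto
  then obtain x where x: "x \<in> H" "x \<noteq> \<one>"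
    by blast
  then have xG: "x \<in> carrier G"
    using H(1) subgroup.subset by blast
  interpret H: group "G\<lparr>carrier := H\<rparr>"
    using subgroup_imp_group[OF H(1)] .
  have "x [^] q = \<one>"
    using H.pow_order_eq_1[of x] x(1) H(2) nat_pow_consistent[of x q H] by (simp add: order_def)
  then have "ord x dvd q"
    using pow_eq_id[OF xG] by simp
  moreover have "ord x \<noteq> 1"
    using ord_eq_1[OF xG] x(2) by simp
  ultimately have "ord x = q"
    using \<open>prime q\<close> prime_nat_iff by blast
  with xG show ?thesis
    using that by blast
qed

text \<open>A prime \<open>q\<close> dividing the \<open>p\<close>-free part \<open>m\<close> of the
  order would be the order of an element by Cauchy's theorem, hence a power of \<open>p\<close>,
  hence \<open>p\<close> itself.\<close>

lemma p_group_order_eq_prime_power: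
  assumes "p_group p G" "finite (carrier G)"
  obtains n where "order G = p ^ n"
proof -
  have p: "prime p" and ords: "\<And>x. x \<in> carrier G \<Longrightarrow> \<exists>k. ord x = p ^ k"
    using assms(1) by (auto simp: p_group_def)
  have pos: "order G \<noteq> 0"
    using assms(2) order_gt_0_iff_finite by simp
  obtain m where m: "order G = p ^ multiplicity p (order G) * m" "\<not> p dvd m"
    using multiplicity_decompose'[OF pos, of p] p by (auto simp: prime_nat_iff)
  have "m = 1"
  proof (rule ccontr)
    assume "m \<noteq> 1"
    then obtain q where q: "prime q" "q dvd m"
      using prime_factor_nat by blast
    then obtain x where "x \<in> carrier G" "ord x = q"
      using prime_dvd_order_imp_exists_ord[OF q(1) assms(2)] m(1) by (metis dvd_mult)
    then obtain k where "q = p ^ k"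
      using ords by metis
    then have "q = p"
      using q(1) by (metis p prime_dvd_power primes_dvd_imp_eq dvd_refl)
    then show False
      using q(2) m(2) by simp
  qed
  then show ?thesis
    using m(1) that by simp
qed

section \<open>The covering by maximal subgroups\<close>

lemma proper_subgroup_in_maximal:
  assumes "finite (carrier G)" "subgroup H G" "H \<noteq> carrier G"
  obtains M where "subgroup M G" "M \<noteq> carrier G" "H \<subseteq> M"
    "\<And>K. \<lbrakk>subgroup K G; M \<subseteq> K; K \<noteq> carrier G\<rbrakk> \<Longrightarrow> K = M"
proof -
  let ?S = "{K. subgroup K G \<and> K \<noteq> carrier G}"
  have "finite ?S"
    by (rule finite_subset[of _ "Pow (carrier G)"])
      (use assms(1) subgroup.subset in auto)
  then obtain M where "M \<in> ?S" "H \<subseteq> M" "\<forall>K\<in>?S. M \<subseteq> K \<longrightarrow> K = M"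
    using finite_has_maximal2[of ?S H] assms(2,3) by auto
  then show ?thesis
    by (intro that[of M]) auto
qed

end

theorem theorem15:
  fixes p :: nat and G :: "('a, 'b) monoid_scheme"
  assumes "prime p"
    and "p_group p G"
    and "finite (carrier G)"
    and "\<not> cyclic_group G"
  shows "\<exists>\<C>. equal_covering G \<C>"
proof -
  interpret group G
    using assms(2) by (simp add: p_group_def)
  obtain n where n: "order G = p ^ n"
    using p_group_order_eq_prime_power[OF assms(2,3)] .
  \<comment> \<open>Members are selected by index \<open>p\<close> instead of maximality, so
    equality of their orders is immediate; maximal subgroups enter only to show that the union is
    all of \<open>G\<close>.\<close>
  define \<C> where "\<C> = {M. subgroup M G \<and> M \<noteq> carrier G \<and> p * card M = order G}"
  have "x \<in> \<Union>\<C>" if x: "x \<in> carrier G" for x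
  proof -
    \<comment> \<open>The generated subgroup consists of the integer powers of \<open>x\<close>,
      which would otherwise witness that \<open>G\<close> is cyclic.\<close>
    have "generate G {x} \<noteq> carrier G"
      using assms(4) x generate_pow[OF x] unfolding cyclic_group by (auto simp: full_SetCompr_eq)
    then obtain M where "subgroup M G" "M \<noteq> carrier G" "generate G {x} \<subseteq> M"
      "\<And>K. \<lbrakk>subgroup K G; M \<subseteq> K; K \<noteq> carrier G\<rbrakk> \<Longrightarrow> K = M"
      using proper_subgroup_in_maximal[OF assms(3) generate_is_subgroup, of "{x}"] x by blast
    then show ?thesis
      using p_group_maximal_index[OF assms(1) n] generate.incl[of x "{x}" G]
      unfolding \<C>_def by blast
  qed
  then have "\<Union>\<C> = carrier G"
    unfolding \<C>_def using subgroup.subset by blast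
  moreover have "\<forall>H\<in>\<C>. subgroup H G \<and> H \<noteq> carrier G"
    by (simp add: \<C>_def)
  moreover have "\<forall>H\<in>\<C>. \<forall>K\<in>\<C>. card H = card K"
  proof (intro ballI)
    fix H K assume "H \<in> \<C>" "K \<in> \<C>"
    then have "p * card H = p * card K"
      unfolding \<C>_def by (metis (mono_tags, lifting) mem_Collect_eq)
    then show "card H = card K"
      using prime_gt_0_nat[OF assms(1)] by simp
  qed
  ultimately show ?thesis
    unfolding equal_covering_def group_covering_def by metis
qed

end
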